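(* Let $a,b,c,d$ be integers satisfying $a\geq b\geq 1$, $c\geq 0$, and $d\geq 2$. Let $A=\{n : n \text{ a positive integer},\ n\equiv bc \pmod a\}$. Then there exist integers $r$ and $s$ satisfying $0\leq r<s<d$ such that $|D_{a,b}(n)|\equiv r \pmod d$ for infinitely many $n\in A$ and $|D_{a,b}(n)|\equiv s \pmod d$ for infinitely many $n\in A$.
   Context: A partition $\lambda$ of a positive integer $n$ is a nonincreasing list of positive integers (called parts) $\lambda_1,\ldots,\lambda_k$ that sum to $n$. For positive integers $a$ and $b$, $D_{a,b}(n)$ denotes the set of partitions of $n$ into distinct parts each congruent to $b$ modulo $a$. *)

theory Defs
  imports "HOL-Number_Theory.Cong"
begin

definition partitions :: "nat \<Rightarrow> nat list set" where
  "partitions n = {xs. sorted_wrt (\<ge>) xs \<and> (\<forall>x \<in> set xs. x > 0) \<and> sum_list xs = n}"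

definition D :: "nat \<Rightarrow> nat \<Rightarrow> nat \<Rightarrow> nat list set" where
  "D a b n = {xs \<in> partitions n. distinct xs \<and> (\<forall>x \<in> set xs. [x = b] (mod a))}"

text \<open>Finiteness, so that \<^term>\<open>card\<close> of these sets is the genuine number of partitions.\<close>

lemma finite_partitions: "finite (partitions n)"
proof (rule finite_subset)
  show "partitions n \<subseteq> {xs. set xs \<subseteq> {..n} \<and> length xs \<le> n}"
  proof
    fix xs assume xs: "xs \<in> partitions n"
    have "length xs \<le> sum_list xs" if "\<forall>x \<in> set xs. x > 0" for xs :: "nat list"
      using that by (induction xs) auto
    then show "xs \<in> {xs. set xs \<subseteq> {..n} \<and> length xs \<le> n}"
      using xs member_le_sum_list by (fastforce simp: partitions_def)
  qed
qed (simp add: finite_lists_length_le)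

lemma finite_D: "finite (D a b n)"
  by (simp add: D_def finite_partitions)

end

theory Submission
  imports Defs "HOL-Library.Infinite_Set" "HOL-Computational_Algebra.Formal_Power_Series"
begin

unbundle fps_syntax

text \<open>
  Let \<open>G\<^sub>m\<close> count the partitions with exactly \<open>m\<close> parts. Then
  \<open>G\<^sub>m = q\<^bsup>e(m)\<^esup> / ((1 - q\<^bsup>a\<^esup>) \<cdots> (1 - q\<^bsup>am\<^esup>))\<close> where \<open>e(m) = b + (b + a) + \<cdots> + (b + a(m - 1))\<close>, and
  the generating function \<open>F\<close> of the \<open>n \<equiv> bc\<close> is the sum of those \<open>G\<^sub>m\<close> with \<open>bm \<equiv> bc (mod a)\<close>.
  Suppose the coefficients of \<open>F\<close> in this class are eventually constant modulo \<open>d\<close>. Multiply \<open>F\<close> by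
  \<open>Q = (1 - q\<^bsup>a\<^esup>) \<cdots> (1 - q\<^bsup>aM\<^esup>)\<close>, where \<open>M + 1 \<equiv> c (mod a)\<close> is large. By assumption the
  coefficient of \<open>q\<^bsup>e(M+1)\<^esup>\<close> in \<open>FQ\<close> vanishes modulo \<open>d\<close>. However, the terms \<open>G\<^sub>m Q\<close> with \<open>m \<le> M\<close>
  are polynomials of degree at most \<open>a(1 + \<cdots> + M) < e(M+1)\<close>, and the remaining terms contribute
  exactly \<open>1\<close> to this coefficient.
\<close>

section \<open>Index sets, their series and the denominators\<close>

text \<open>A partition is encoded by the set of the indices \<open>k\<close> of its parts \<open>b + ak\<close>.\<close>

definition index_sets :: "nat \<Rightarrow> nat \<Rightarrow> nat \<Rightarrow> nat set set" where
  "index_sets a b n = {T. finite T \<and> (\<Sum>k\<in>T. b + a * k) = n}"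

definition index_sets_card :: "nat \<Rightarrow> nat \<Rightarrow> nat \<Rightarrow> nat \<Rightarrow> nat set set" where
  "index_sets_card a b m n = {T \<in> index_sets a b n. card T = m}"

text \<open>This is \<open>G_m\<close> of the overview. Integer coefficients permit subtraction and
  make subdegrees additive under products.\<close>

definition parts_fps :: "nat \<Rightarrow> nat \<Rightarrow> nat \<Rightarrow> int fps" where
  "parts_fps a b m = Abs_fps (\<lambda>n. int (card (index_sets_card a b m n)))"

definition min_sum :: "nat \<Rightarrow> nat \<Rightarrow> nat \<Rightarrow> nat" where
  "min_sum a b m = (\<Sum>k<m. b + a * k)"

text \<open>The q-Pochhammer symbol \<open>(q^a; q^a)_m\<close>, the denominator of
  \<open>G_m\<close>.\<close>

definition qfact :: "nat \<Rightarrow> nat \<Rightarrow> int fps" where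
  "qfact a m = (\<Prod>i=1..m. 1 - fps_X ^ (a * i))"

lemma qfact_0 [simp]: "qfact a 0 = 1"
  by (simp add: qfact_def)

lemma qfact_Suc: "qfact a (Suc m) = qfact a m * (1 - fps_X ^ (a * Suc m))"
  by (simp add: qfact_def)

lemma qfact_nth_0: "a > 0 \<Longrightarrow> qfact a m $ 0 = 1"
  by (induction m) (simp_all add: qfact_Suc)

section \<open>From partitions to index sets\<close>

lemma inj_on_part: "a > 0 \<Longrightarrow> inj_on (\<lambda>k. b + a * k) (T :: nat set)"
  by (auto simp: inj_on_def)

text \<open>As \<open>1 <= b <= a\<close>, the least positive member of the residue class is
  \<open>b\<close>: a positive \<open>x < b\<close> in it would make \<open>a\<close> divide
  \<open>b - x\<close>, which lies strictly between \<open>0\<close> and \<open>a\<close>.\<close>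

lemma part_conv:
  fixes a b x :: nat
  assumes "b \<ge> 1" "a \<ge> b"
  shows "x > 0 \<and> [x = b] (mod a) \<longleftrightarrow> x \<in> range (\<lambda>k. b + a * k)"
proof
  assume x: "x > 0 \<and> [x = b] (mod a)"
  have "b \<le> x"
  proof (rule ccontr)
    assume "\<not> b \<le> x"
    then have "a dvd b - x" "b - x > 0" "b - x < a"
      using x assms by (auto simp: cong_altdef_nat cong_sym_eq[of x])
    then show False by (auto dest: dvd_imp_le)
  qed
  then have "a dvd x - b" using x by (simp add: cong_altdef_nat)
  then obtain k where "x - b = a * k" by (elim dvdE)
  then have "x = b + a * k" using \<open>b \<le> x\<close> by simp
  then show "x \<in> range (\<lambda>k. b + a * k)" by blast
next
  assume "x \<in> range (\<lambda>k. b + a * k)"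
  then show "x > 0 \<and> [x = b] (mod a)" using assms by (auto simp: cong_def)
qed

text \<open>A set of parts has exactly one decreasing enumeration, so listing the parts and taking
  preimages of part sets are mutually inverse.\<close>

lemma card_D:
  assumes "b \<ge> 1" "a \<ge> b"
  shows "card (D a b n) = card (index_sets a b n)"
proof -
  let ?g = "\<lambda>k. b + a * k"
  have inj: "inj ?g" using assms by (auto intro: inj_on_part)
  have "bij_betw (\<lambda>T. rev (sorted_list_of_set (?g ` T))) (index_sets a b n) (D a b n)"
  proof (rule bij_betw_byWitness[where f' = "\<lambda>xs. ?g -` set xs"])
    show "\<forall>T\<in>index_sets a b n. ?g -` set (rev (sorted_list_of_set (?g ` T))) = T"
      using inj by (auto simp: index_sets_def inj_vimage_image_eq)
    show "\<forall>xs\<in>D a b n. rev (sorted_list_of_set (?g ` (?g -` set xs))) = xs"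
    proof
      fix xs assume xs: "xs \<in> D a b n"
      then have "set xs \<subseteq> range ?g"
        by (intro subsetI, intro part_conv[OF assms, THEN iffD1]) (auto simp: D_def partitions_def)
      then have im: "?g ` (?g -` set xs) = set xs" by auto
      have "sorted (rev xs)" "distinct (rev xs)"
        using xs by (auto simp: D_def partitions_def sorted_wrt_rev)
      then have "sorted_list_of_set (set (rev xs)) = rev xs"
        using sorted_list_of_set.idem_if_sorted_distinct by blast
      then have "sorted_list_of_set (set xs) = rev xs" by simp
      then show "rev (sorted_list_of_set (?g ` (?g -` set xs))) = xs"
        unfolding im by simp
    qed
    show "(\<lambda>T. rev (sorted_list_of_set (?g ` T))) ` index_sets a b n \<subseteq> D a b n"
    proof safe
      fix T assume T: "T \<in> index_sets a b n"
      let ?xs = "rev (sorted_list_of_set (?g ` T))"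
      have fin: "finite (?g ` T)" using T by (simp add: index_sets_def)
      have "sum_list ?xs = \<Sum>(set ?xs)"
        by (rule distinct_sum_list_conv_Sum) simp
      also have "\<dots> = \<Sum>(?g ` T)" using fin by simp
      also have "\<dots> = n"
        using T inj by (simp add: index_sets_def sum.reindex inj_on_subset)
      finally have "sum_list ?xs = n" .
      moreover have "sorted_wrt (\<ge>) ?xs" by (simp add: sorted_wrt_rev)
      moreover have "x > 0 \<and> [x = b] (mod a)" if "x \<in> set ?xs" for x
        using that fin part_conv[OF assms, of x] by auto
      ultimately show "?xs \<in> D a b n" by (auto simp: D_def partitions_def)
    qed
    show "(\<lambda>xs. ?g -` set xs) ` D a b n \<subseteq> index_sets a b n"
    proof safe
      fix xs assume xs: "xs \<in> D a b n"
      then have "set xs \<subseteq> range ?g"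
        by (intro subsetI, intro part_conv[OF assms, THEN iffD1]) (auto simp: D_def partitions_def)
      then have im: "?g ` (?g -` set xs) = set xs" by auto
      have "(\<Sum>k\<in>?g -` set xs. ?g k) = \<Sum>(?g ` (?g -` set xs))"
        by (simp only: sum.reindex[OF inj_on_subset[OF inj subset_UNIV]] o_def)
      also have "\<dots> = n"
        unfolding im using xs distinct_sum_list_conv_Sum[of xs] by (simp add: D_def partitions_def)
      finally show "?g -` set xs \<in> index_sets a b n"
        using inj by (simp add: index_sets_def finite_vimageI)
    qed
  qed
  then show ?thesis by (simp add: bij_betw_same_card)
qed

section \<open>The product formula for a fixed number of parts\<close>

lemma finite_index_sets:
  assumes "a > 0"
  shows "finite (index_sets a b n)"
proof (rule finite_subset)
  show "index_sets a b n \<subseteq> Pow {..n}"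
  proof safe
    fix T k assume T: "T \<in> index_sets a b n" and "k \<in> T"
    have "k \<le> b + a * k" using assms by (simp add: trans_le_add2)
    also have "\<dots> \<le> (\<Sum>k\<in>T. b + a * k)"
      using T \<open>k \<in> T\<close> by (intro member_le_sum) (auto simp: index_sets_def)
    finally show "k \<le> n" using T by (simp add: index_sets_def)
  qed
qed simp

lemma finite_index_sets_card: "a > 0 \<Longrightarrow> finite (index_sets_card a b m n)"
  using finite_index_sets by (simp add: index_sets_card_def)

lemma sum_shift:
  "finite T \<Longrightarrow> (\<Sum>k\<in>Suc ` T. b + a * k) = (\<Sum>k\<in>T. b + a * k) + a * card T"
  by (simp add: sum.reindex sum.distrib card_image algebra_simps)

text \<open>Either all indices are positive, and all of them are lowered by one, or the part \<open>b\<close> occurs, and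
  it is removed before the others are lowered.\<close>

lemma index_sets_card_Suc:
  "index_sets_card a b (Suc m) n =
     (if n < a * Suc m then {} else (`) Suc ` index_sets_card a b (Suc m) (n - a * Suc m)) \<union>
     (if n < b + a * m then {}
      else (\<lambda>T. insert 0 (Suc ` T)) ` index_sets_card a b m (n - (b + a * m)))"
    (is "?L = ?R1 \<union> ?R2")
proof (intro equalityI subsetI)
  fix T assume "T \<in> ?L"
  then have T: "finite T" "card T = Suc m" "(\<Sum>k\<in>T. b + a * k) = n"
    by (auto simp: index_sets_card_def index_sets_def)
  define U where "U = Suc -` T"
  have finU: "finite U" using T by (simp add: U_def finite_vimageI)
  have SU: "Suc ` U = T - {0}"
  proof (rule set_eqI)
    show "k \<in> Suc ` U \<longleftrightarrow> k \<in> T - {0}" for k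
      by (cases k) (auto simp: U_def)
  qed
  show "T \<in> ?R1 \<union> ?R2"
  proof (cases "0 \<in> T")
    case True
    then have TU: "T = insert 0 (Suc ` U)" using SU by blast
    then have card: "card U = m" using T finU by (simp add: card_image)
    have "n = b + ((\<Sum>k\<in>U. b + a * k) + a * m)"
      using T(3) finU card unfolding TU by (subst (asm) sum.insert) (auto simp: sum_shift)
    then have "\<not> n < b + a * m" "U \<in> index_sets_card a b m (n - (b + a * m))"
      using finU card by (auto simp: index_sets_card_def index_sets_def)
    then show ?thesis using TU by auto
  next
    case False
    then have TU: "T = Suc ` U" using SU by blast
    then have card: "card U = Suc m" using T by (simp add: card_image)
    have "n = (\<Sum>k\<in>U. b + a * k) + a * Suc m"
      using T(3) finU card unfolding TU by (simp only: sum_shift)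
    then have "\<not> n < a * Suc m" "U \<in> index_sets_card a b (Suc m) (n - a * Suc m)"
      using finU card by (auto simp: index_sets_card_def index_sets_def)
    then show ?thesis using TU by auto
  qed
next
  fix T assume "T \<in> ?R1 \<union> ?R2"
  then consider
      U where "n \<ge> a * Suc m" "U \<in> index_sets_card a b (Suc m) (n - a * Suc m)" "T = Suc ` U"
    | U where "n \<ge> b + a * m" "U \<in> index_sets_card a b m (n - (b + a * m))"
        "T = insert 0 (Suc ` U)"
    by (auto simp del: mult_Suc_right split: if_splits)
  then show "T \<in> ?L"
  proof cases
    case 1
    then show ?thesis
      by (auto simp: index_sets_card_def index_sets_def sum_shift card_image simp del: mult_Suc_right)
  next
    case 2
    then have U: "finite U" "card U = m" "(\<Sum>k\<in>U. b + a * k) = n - (b + a * m)"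
      by (auto simp: index_sets_card_def index_sets_def)
    then have "(\<Sum>k\<in>T. b + a * k) = b + (n - (b + a * m) + a * m)"
      unfolding 2 by (subst sum.insert) (auto simp: sum_shift)
    with 2(1) U show ?thesis
      unfolding 2 by (simp add: index_sets_card_def index_sets_def card_image)
  qed
qed

text \<open>The two summands count the partitions without and with the part \<open>b\<close>. The
  two families are disjoint, since only the second has the index \<open>0\<close>.\<close>

lemma parts_fps_Suc:
  assumes "a > 0"
  shows "parts_fps a b (Suc m) =
    fps_X ^ (a * Suc m) * parts_fps a b (Suc m) + fps_X ^ (b + a * m) * parts_fps a b m"
proof (rule fps_ext)
  fix n
  have inj1: "inj_on ((`) Suc) X" for X by (simp add: inj_on_def inj_image_eq_iff)
  have inj2: "inj_on (\<lambda>T. insert 0 (Suc ` T)) X" for X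
  proof (rule inj_onI)
    fix S T assume "insert 0 (Suc ` S) = insert 0 (Suc ` T)"
    then have "Suc ` S = Suc ` T" by (auto simp: set_eq_iff)
    then show "S = T" by (simp add: inj_image_eq_iff)
  qed
  have "card (index_sets_card a b (Suc m) n) =
     card (if n < a * Suc m then {} else (`) Suc ` index_sets_card a b (Suc m) (n - a * Suc m)) +
     card (if n < b + a * m then {}
           else (\<lambda>T. insert 0 (Suc ` T)) ` index_sets_card a b m (n - (b + a * m)))"
    by (subst index_sets_card_Suc, subst card_Un_disjoint)
      (auto simp: finite_index_sets_card assms simp del: mult_Suc_right)
  then show "parts_fps a b (Suc m) $ n =
      (fps_X ^ (a * Suc m) * parts_fps a b (Suc m) + fps_X ^ (b + a * m) * parts_fps a b m) $ n"
    by (simp add: parts_fps_def fps_X_power_mult_nth card_image inj1 inj2 del: mult_Suc_right)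
qed

lemma parts_fps_0: "parts_fps a b 0 = 1"
proof (rule fps_ext)
  fix n
  have "index_sets_card a b 0 n = (if n = 0 then {{}} else {})"
    by (auto simp: index_sets_card_def index_sets_def card_gt_0_iff)
  then show "parts_fps a b 0 $ n = 1 $ n" by (simp add: parts_fps_def)
qed

text \<open>The product formula for \<open>G_m\<close>, stated without division. Solving the
  recursion for \<open>G_(m+1)\<close> contributes one factor of the denominator per step.\<close>

lemma parts_fps_mult_qfact:
  assumes "a > 0"
  shows "parts_fps a b m * qfact a m = fps_X ^ min_sum a b m"
proof (induction m)
  case 0
  then show ?case by (simp add: parts_fps_0 min_sum_def)
next
  case (Suc m)
  have "parts_fps a b (Suc m) * (1 - fps_X ^ (a * Suc m)) = fps_X ^ (b + a * m) * parts_fps a b m"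
    using parts_fps_Suc[OF assms, of b m] by (simp add: algebra_simps)
  then have "parts_fps a b (Suc m) * qfact a (Suc m)
      = fps_X ^ (b + a * m) * (parts_fps a b m * qfact a m)"
    by (simp add: qfact_Suc mult_ac)
  also have "\<dots> = fps_X ^ min_sum a b (Suc m)"
    unfolding Suc by (simp add: min_sum_def add_ac flip: power_add)
  finally show ?case .
qed

text \<open>The denominator has constant term \<open>1\<close>, hence subdegree \<open>0\<close>, so
  \<open>G_m\<close> has the same lowest term as the numerator \<open>q^e(m)\<close>.\<close>

lemma parts_fps_nth:
  assumes "a > 0" "n \<le> min_sum a b m"
  shows "parts_fps a b m $ n = (if n = min_sum a b m then 1 else 0)"
proof -
  let ?G = "parts_fps a b m" and ?Q = "qfact a m"
  have Q0: "?Q $ 0 = 1" by (simp add: qfact_nth_0 assms)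
  have "?G \<noteq> 0" "?Q \<noteq> 0" using parts_fps_mult_qfact[OF assms(1), of b m] by auto
  then have "subdegree (?G * ?Q) = subdegree ?G + subdegree ?Q" by simp
  moreover have "subdegree ?Q = 0" using Q0 by (intro subdegreeI) auto
  ultimately have sd: "subdegree ?G = min_sum a b m"
    using parts_fps_mult_qfact[OF assms(1), of b m] by simp
  have "?G $ min_sum a b m * ?Q $ 0 = (?G * ?Q) $ min_sum a b m"
    using nth_subdegree_mult[of ?G ?Q] sd \<open>subdegree ?Q = 0\<close> by simp
  then have "?G $ min_sum a b m = 1"
    using Q0 parts_fps_mult_qfact[OF assms(1), of b m] by simp
  moreover have "?G $ n = 0" if "n < min_sum a b m"
    using that sd by (simp add: nth_less_subdegree_zero)
  ultimately show ?thesis using assms by auto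
qed

lemma strict_mono_min_sum: "b \<ge> 1 \<Longrightarrow> strict_mono (min_sum a b)"
  by (simp add: strict_mono_Suc_iff min_sum_def)

section \<open>Expansion by the number of parts\<close>

lemma index_sets_card_cong:
  assumes "index_sets_card a b m n \<noteq> {}"
  shows "[n = b * m] (mod a)"
proof -
  obtain T where "finite T" "card T = m" "(\<Sum>k\<in>T. b + a * k) = n"
    using assms by (auto simp: index_sets_card_def index_sets_def)
  then have "n = b * m + a * (\<Sum>k\<in>T. k)"
    by (auto simp: sum.distrib sum_distrib_left)
  then show ?thesis by (simp add: cong_def)
qed

text \<open>More than \<open>K\<close> parts already sum to at least
  \<open>min_sum a b (Suc K)\<close>. The finite sum thus replaces the infinite sum of all
  \<open>G_m\<close> in low degrees.\<close>

lemma card_D_eq_sum: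
  assumes "b \<ge> 1" "a \<ge> b" "n < min_sum a b (Suc K)"
  shows "int (card (D a b n)) = (\<Sum>m\<le>K. parts_fps a b m $ n)"
proof -
  have a: "a > 0" using assms by simp
  have empty: "index_sets_card a b m n = {}" if "m > K" for m
  proof -
    have "n < min_sum a b m"
      using assms(3) strict_mono_less_eq[OF strict_mono_min_sum[OF assms(1)], of a "Suc K" m] that
      by auto
    then have "parts_fps a b m $ n = 0" using parts_fps_nth[OF a, of n b m] by simp
    then show ?thesis by (simp add: parts_fps_def finite_index_sets_card a)
  qed
  have "card T \<le> K" if "T \<in> index_sets a b n" for T
    by (rule ccontr) (use empty[of "card T"] that in \<open>auto simp: index_sets_card_def\<close>)
  then have "index_sets a b n = (\<Union>m\<le>K. index_sets_card a b m n)"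
    by (auto simp: index_sets_card_def)
  moreover have "card (\<Union>m\<le>K. index_sets_card a b m n)
      = (\<Sum>m\<le>K. card (index_sets_card a b m n))"
    by (rule card_UN_disjoint) (auto simp: finite_index_sets_card a, auto simp: index_sets_card_def)
  ultimately show ?thesis using card_D[OF assms(1,2), of n] by (simp add: parts_fps_def)
qed

section \<open>Products with the denominators in high degrees\<close>

text \<open>Each new factor \<open>1 - q^(a(M+1))\<close> takes a difference of two coefficients at
  distance \<open>a(M+1)\<close>, and the threshold grows by just that amount. The case
  \<open>d = 0\<close> bounds degrees; the case of the given modulus handles eventually constant
  residues.\<close>

lemma dvd_nth_mult_qfact:
  fixes f :: "int fps"
  assumes "\<And>n. n \<ge> L + a * \<Sum>{..m} \<Longrightarrow> d dvd (f * qfact a m) $ n" "m \<le> M"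
    and "n \<ge> L + a * \<Sum>{..M}"
  shows "d dvd (f * qfact a M) $ n"
  using assms(2,3)
proof (induction M arbitrary: n rule: dec_induct)
  case base
  then show ?case using assms(1) by blast
next
  case (step M)
  have "(f * qfact a (Suc M)) $ n
      = (f * qfact a M) $ n - (fps_X ^ (a * Suc M) * (f * qfact a M)) $ n"
    by (simp add: qfact_Suc algebra_simps)
  also have "\<dots> = (f * qfact a M) $ n - (f * qfact a M) $ (n - a * Suc M)"
    using step.prems by (simp only: fps_X_power_mult_nth) (simp add: algebra_simps)
  also have "d dvd \<dots>"
    by (intro dvd_diff step.IH) (use step.prems in \<open>simp_all add: algebra_simps\<close>)
  finally show ?case .
qed

text \<open>Divisibility by \<open>0\<close> means vanishing. The product starts as the monomial
  \<open>q^e(m)\<close>, whose degree is at most \<open>a * \<Sum>{..m}\<close> because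
  \<open>b <= a\<close>.\<close>

lemma parts_fps_mult_qfact_nth_eq_0:
  assumes "a > 0" "a \<ge> b" "m \<le> M" "n > a * \<Sum>{..M}"
  shows "(parts_fps a b m * qfact a M) $ n = 0"
proof -
  have le: "min_sum a b m \<le> a * \<Sum>{..m}" for m
  proof (induction m)
    case (Suc m)
    then show ?case using assms(2) by (simp add: min_sum_def algebra_simps)
  qed (simp add: min_sum_def)
  have "0 dvd (parts_fps a b m * qfact a M) $ n"
  proof (rule dvd_nth_mult_qfact[where L = 1 and m = m])
    fix n assume "1 + a * \<Sum>{..m} \<le> n"
    then show "0 dvd (parts_fps a b m * qfact a m) $ n"
      using le[of m] by (simp add: parts_fps_mult_qfact assms)
  qed (use assms in auto)
  then show ?thesis by simp
qed

lemma min_sum_Suc: "min_sum a b (Suc M) = b * Suc M + a * \<Sum>{..M}"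
  by (induction M) (simp_all add: min_sum_def algebra_simps)

section \<open>The contradiction from an eventually constant residue\<close>

lemma not_eventually_const:
  fixes a b c d N :: nat
  assumes "b \<ge> 1" "a \<ge> b" "d \<ge> 2"
    and const: "\<And>n. n \<ge> N \<Longrightarrow> [n = b * c] (mod a) \<Longrightarrow> [card (D a b n) = r] (mod d)"
  shows False
proof -
  have a: "a > 0" using assms by simp
  \<comment> \<open>The term \<open>c\<close> puts \<open>e(M+1)\<close> into the class of
    \<open>bc\<close>; the multiple of \<open>a\<close> makes \<open>M >= N + a\<close>, so that
    \<open>e\<close> passes both thresholds \<open>N + a * \<Sum>{..M}\<close> and
    \<open>a * \<Sum>{..M}\<close>.\<close>
  define M where "M = c + a * (N + a + 1) - 1"
  have "a * (N + a + 1) \<ge> N + a + 1" using a by (cases a) simp_all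
  then have SucM: "Suc M = c + a * (N + a + 1)" and M: "M \<ge> N + a"
    unfolding M_def by linarith+
  then have "M \<ge> 1" using a by linarith
  have cong_M: "[b * Suc M = b * c] (mod a)"
    unfolding SucM by (intro cong_scalar_left) (simp only: cong_def mod_mult_self2)
  define e where "e = min_sum a b (Suc M)"
  have "b * Suc M \<ge> Suc M" using mult_le_mono1[OF assms(1), of "Suc M"] by (simp only: mult_1)
  then have e: "e \<ge> Suc M + a * \<Sum>{..M}" by (simp only: e_def min_sum_Suc)
  define F where
    "F = Abs_fps (\<lambda>n. if [n = b * c] (mod a) then int (card (D a b n)) else 0)"
  define S where "S = {m. m \<le> M \<and> [b * m = b * c] (mod a)}"
  \<comment> \<open>The part of \<open>F\<close> from partitions with more than \<open>M\<close>
    parts; up to degree \<open>e\<close> it agrees with \<open>q^e\<close>.\<close>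
  define tail where "tail = F - (\<Sum>m\<in>S. parts_fps a b m)"

  have "int d dvd (F * qfact a M) $ e"
  \<comment> \<open>The first factor \<open>1 - q^a\<close> subtracts neighbouring members of the
    class, which have equal residues once both are at least \<open>N\<close>; this is why
    \<open>m = 1\<close> is the base.\<close>
  proof (rule dvd_nth_mult_qfact[where L = N and m = 1])
    fix n assume n: "N + a * \<Sum>{..1} \<le> n"
    then have n': "n \<ge> N + a" by simp
    have c: "[n - a = b * c] (mod a) \<longleftrightarrow> [n = b * c] (mod a)"
      using n' by (simp add: cong_def le_mod_geq)
    have "(F * qfact a 1) $ n = F $ n - (fps_X ^ a * F) $ n"
      by (simp add: qfact_def algebra_simps)
    also have "\<dots> = F $ n - F $ (n - a)" using n' by (simp add: fps_X_power_mult_nth)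
    also have "int d dvd \<dots>"
    proof (cases "[n = b * c] (mod a)")
      case True
      then have "[card (D a b n) = card (D a b (n - a))] (mod d)"
        using const[of n] const[of "n - a"] n' c by (metis add_le_imp_le_diff cong_sym cong_trans add_leD1)
      then show ?thesis using True c by (simp add: F_def cong_iff_dvd_diff flip: cong_int_iff)
    qed (simp add: F_def c)
    finally show "int d dvd (F * qfact a 1) $ n" .
  qed (use M e \<open>M \<ge> 1\<close> in auto)
  moreover have "(F * qfact a M) $ e = 1"
  proof -
    have tail: "tail $ n = (if n = e then 1 else 0)" if "n \<le> e" for n
    proof -
      have "min_sum a b (Suc M) < min_sum a b (Suc (Suc M))"
        using strict_mono_min_sum[OF assms(1)] by (simp add: strict_mono_def)
      then have D: "int (card (D a b n)) = (\<Sum>m\<le>Suc M. parts_fps a b m $ n)"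
        using that by (intro card_D_eq_sum assms) (simp add: e_def)
      have z: "parts_fps a b m $ n = 0" if "\<not> [n = b * m] (mod a)" for m
      proof -
        have "index_sets_card a b m n = {}" using index_sets_card_cong that by blast
        then show ?thesis by (simp add: parts_fps_def)
      qed
      have last: "parts_fps a b (Suc M) $ n = (if n = e then 1 else 0)"
        using parts_fps_nth[OF a, of n b "Suc M"] that by (simp add: e_def)
      show ?thesis
      proof (cases "[n = b * c] (mod a)")
        case True
        have "(\<Sum>m\<in>S. parts_fps a b m $ n) = (\<Sum>m\<le>M. parts_fps a b m $ n)"
        proof (rule sum.mono_neutral_left)
          show "\<forall>m\<in>{..M} - S. parts_fps a b m $ n = 0"
            using z True by (auto simp: S_def) (metis cong_sym cong_trans)
        qed (auto simp: S_def)
        then show ?thesis using True D last by (simp add: tail_def F_def fps_sum_nth)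
      next
        case False
        have "(\<Sum>m\<in>S. parts_fps a b m $ n) = 0"
          using z False by (intro sum.neutral) (auto simp: S_def dest: cong_trans)
        \<comment> \<open>The coefficient of \<open>G_(M+1)\<close> at \<open>e\<close> is
          \<open>1\<close>, so \<open>e\<close> lies in the class of \<open>b(M+1)\<close>, which is
          that of \<open>bc\<close>.\<close>
        moreover have "n \<noteq> e"
        proof -
          have "\<not> [n = b * Suc M] (mod a)" using False cong_M cong_trans by blast
          then have "parts_fps a b (Suc M) $ n = 0" by (rule z)
          then show ?thesis using last by (metis zero_neq_one)
        qed
        ultimately show ?thesis using False by (simp add: tail_def F_def fps_sum_nth)
      qed
    qed
    have "(tail * qfact a M) $ e = (\<Sum>i=0..e. if i = e then qfact a M $ 0 else 0)"
      unfolding fps_mult_nth by (rule sum.cong) (auto simp: tail)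
    then have "(tail * qfact a M) $ e = 1" using a by (simp add: qfact_nth_0)
    moreover have "(parts_fps a b m * qfact a M) $ e = 0" if "m \<in> S" for m
      using that e assms a by (intro parts_fps_mult_qfact_nth_eq_0) (auto simp: S_def)
    moreover have "F * qfact a M = tail * qfact a M + (\<Sum>m\<in>S. parts_fps a b m * qfact a M)"
      by (simp add: tail_def left_diff_distrib flip: sum_distrib_right)
    ultimately show ?thesis by (simp add: fps_sum_nth)
  qed
  ultimately show False using assms(3) by simp
qed

section \<open>Pigeonhole and conclusion\<close>

text \<open>The pigeonhole principle is applied twice: to \<open>A\<close>, giving \<open>r\<close>,
  and then to the members of \<open>A\<close> that avoid the residue \<open>r\<close>, which are
  still unbounded.\<close>

lemma two_values_infinitely_often:
  fixes A :: "nat set" and f :: "nat \<Rightarrow> nat"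
  assumes "d > 0" and const: "\<And>r N. \<exists>n\<in>A. n \<ge> N \<and> \<not> [f n = r] (mod d)"
  shows "\<exists>r s. r < s \<and> s < d \<and> infinite {n \<in> A. [f n = r] (mod d)} \<and>
    infinite {n \<in> A. [f n = s] (mod d)}"
proof -
  have A: "infinite X" if "\<And>N. \<exists>n\<in>X. n \<ge> N" for X :: "nat set"
    using that unfolding infinite_nat_iff_unbounded_le by blast
  have ex: "\<exists>r<d. infinite {n \<in> B. [f n = r] (mod d)}" if "infinite B" for B
  proof -
    have "\<exists>r\<in>{..<d}. infinite {n \<in> B. f n mod d = r}"
      by (rule pigeonhole_infinite_rel[OF that, where R = "\<lambda>n r. f n mod d = r"]) 
        (use assms(1) in auto)
    then show ?thesis by (auto simp: cong_def)
  qed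
  have "infinite A" using const by (intro A) blast
  then obtain r where r: "r < d" "infinite {n \<in> A. [f n = r] (mod d)}" using ex by blast
  have "infinite {n \<in> A. \<not> [f n = r] (mod d)}" using const by (intro A) blast
  then obtain s where s: "s < d"
      "infinite {n \<in> {n \<in> A. \<not> [f n = r] (mod d)}. [f n = s] (mod d)}"
    using ex by blast
  have "r \<noteq> s" using s(2) by auto
  moreover have "infinite {n \<in> A. [f n = s] (mod d)}"
    using s(2) by (rule contrapos_nn) (erule rev_finite_subset, auto)
  ultimately show ?thesis using r s(1) by (cases r s rule: linorder_cases) blast+
qed

theorem theorem1:
  fixes a b c d :: nat and A :: "nat set"
  assumes "a \<ge> b" and "b \<ge> 1" and "c \<ge> 0" and "d \<ge> 2"
    and "A = {n. n > 0 \<and> [n = b * c] (mod a)}"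
  shows "\<exists>r s :: nat. 0 \<le> r \<and> r < s \<and> s < d \<and>
    infinite {n \<in> A. [card (D a b n) = r] (mod d)} \<and>
    infinite {n \<in> A. [card (D a b n) = s] (mod d)}"
proof -
  have "\<exists>n\<in>A. n \<ge> N \<and> \<not> [card (D a b n) = r] (mod d)" for r N
  proof (rule ccontr)
    assume "\<not> ?thesis"
    \<comment> \<open>The bound \<open>Suc N\<close> instead of \<open>N\<close> ensures
      \<open>n > 0\<close>, as membership in \<open>A\<close> demands.\<close>
    then have "[card (D a b n) = r] (mod d)" if "n \<ge> Suc N" "[n = b * c] (mod a)" for n
      using that assms(5) by (metis (mono_tags, lifting) Suc_leD less_le_trans mem_Collect_eq zero_less_Suc)
    then show False using not_eventually_const assms by blast
  qed
  then show ?thesis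
    using two_values_infinitely_often[of d A "\<lambda>n. card (D a b n)"] assms(4) by auto
qed

end
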